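(* Let $\mathcal{K}$ be the set of all compact countable subsets of $\mathbb{R}$, and let $\sim$ be the equivalence relation on $\mathcal{K}$ defined by: $K_1\sim K_2$ if and only if there exists a continuous bijection $f\colon K_1\to K_2$. Then the set $\mathscr{K}=\mathcal{K}/{\sim}$ of all equivalence classes has cardinality $\aleph_1$.
   Context: A countable set is one that is either finite (possibly empty) or countably infinite. Subsets of $\mathbb{R}$ carry the subspace topology. Since the elements of $\mathcal{K}$ are compact subsets of $\mathbb{R}$, $K_1\sim K_2$ holds if and only if $K_1$ and $K_2$ are homeomorphic, and $\sim$ is an equivalence relation on $\mathcal{K}$. *)

theory Defs
  imports "HOL-Analysis.Analysis"
begin

unbundle cardinal_syntax

definition countable_compacts :: "real set set" where
  "countable_compacts = {K. compact K \<and> countable K}"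

definition cont_bij_rel :: "real set rel" where
  "cont_bij_rel =
    {(K1, K2). K1 \<in> countable_compacts \<and> K2 \<in> countable_compacts \<and>
       (\<exists>f. continuous_on K1 f \<and> bij_betw f K1 K2)}"

lemma cont_bij_rel_iff_homeomorphic:
  "(K1, K2) \<in> cont_bij_rel \<longleftrightarrow>
     K1 \<in> countable_compacts \<and> K2 \<in> countable_compacts \<and> K1 homeomorphic K2"
proof
  assume "(K1, K2) \<in> cont_bij_rel"
  then obtain f where K: "K1 \<in> countable_compacts" "K2 \<in> countable_compacts"
    and f: "continuous_on K1 f" "bij_betw f K1 K2"
    unfolding cont_bij_rel_def by blast
  have "compact K1"
    using K(1) by (simp add: countable_compacts_def)
  then have "K1 homeomorphic K2"
    using homeomorphic_compact[OF _ f(1)] f(2) unfolding bij_betw_def by blast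
  with K show "K1 \<in> countable_compacts \<and> K2 \<in> countable_compacts \<and> K1 homeomorphic K2"
    by blast
next
  assume *: "K1 \<in> countable_compacts \<and> K2 \<in> countable_compacts \<and> K1 homeomorphic K2"
  then obtain f g where fg: "homeomorphism K1 K2 f g"
    unfolding homeomorphic_def by blast
  have "inj_on f K1"
    by (rule inj_on_inverseI[of _ g]) (rule homeomorphism_apply1[OF fg])
  then have "bij_betw f K1 K2"
    unfolding bij_betw_def using homeomorphism_image1[OF fg] by blast
  with * homeomorphism_cont1[OF fg] show "(K1, K2) \<in> cont_bij_rel"
    unfolding cont_bij_rel_def by blast
qed

lemma equiv_cont_bij_rel: "equiv countable_compacts cont_bij_rel"
proof (rule equivI)
  show "cont_bij_rel \<subseteq> countable_compacts \<times> countable_compacts"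
    by (auto simp: cont_bij_rel_def)
  show "refl_on countable_compacts cont_bij_rel"
    by (auto simp: refl_on_def cont_bij_rel_iff_homeomorphic homeomorphic_refl)
  show "sym cont_bij_rel"
    using homeomorphic_sym unfolding sym_def cont_bij_rel_iff_homeomorphic by blast
  show "trans cont_bij_rel"
    using homeomorphic_trans unfolding trans_def cont_bij_rel_iff_homeomorphic by blast
qed

text \<open>The first uncountable cardinal is the cardinal successor of \<^const>\<open>natLeq\<close>, the
  canonical cardinal order of size aleph-0. It is determined only up to order isomorphism, so
  cardinalities are compared to it with \<^const>\<open>ordIso\<close>.\<close>

definition aleph1 :: "nat set rel" where
  "aleph1 = cardSuc natLeq"

end

theory Submission
  imports Defs "HOL-Library.Countable_Set_Type"
begin

text \<open>Upper bound, without Cantor--Bendixson ranks: every countable compact set is homeomorphic to a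
  compact set of reals that is well-ordered by \<open>\<le>\<close>. Otherwise the points without a neighbourhood of
  this kind form a nonempty closed countable set, which by Baire's theorem has an isolated point
  \<open>x\<close>; a clopen neighbourhood of \<open>x\<close> is \<open>x\<close> together with disjoint clopen pieces of this kind, and
  laying out well-ordered copies of the pieces one after the other, with \<open>x\<close> as the limit, gives a
  contradiction. Compact well-ordered sets of reals with the same order type are homeomorphic, and
  there are \<open>\<aleph>\<^sub>1\<close> countable order types.

  Lower bound: if there were only countably many classes, one could lay out two copies of a
  representative of each class in a single countable compact set. This set would contain two disjoint
  copies of itself, hence a Cantor scheme, and would be uncountable.\<close>

section \<open>Placing countably many sets side by side\<close>

text \<open>The ranges of the maps \<open>tile n\<close> are disjoint intervals that increase with \<open>n\<close> and converge to
  \<open>pi / 2\<close>.\<close>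
definition tile :: "nat \<Rightarrow> real \<Rightarrow> real" where
  "tile n x = arctan (real n + arctan x / 4)"

text \<open>Since \<open>\<bar>arctan x\<bar> < pi/2 < 2\<close>, dividing by 4 keeps the offset
  strictly within 1/2 of 0. The arguments \<open>real n + arctan x / 4\<close> for distinct
  \<open>n\<close> therefore lie in disjoint intervals.\<close>

lemma tile_arg_bounds: "- (1/2) < arctan x / 4" "arctan x / 4 < 1/2"
  using arctan_bounded[of x] pi_less_4 by auto

lemma tile_less_iff [simp]: "tile n x < tile n y \<longleftrightarrow> x < y"
  by (simp add: tile_def arctan_less_iff)

lemma tile_le_iff [simp]: "tile n x \<le> tile n y \<longleftrightarrow> x \<le> y"
  by (simp add: tile_def arctan_le_iff)

lemma tile_less:
  assumes "n < m"
  shows "tile n x < tile m y"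
proof -
  have "real n + 1 \<le> real m"
    using assms by linarith
  then show ?thesis
    using tile_arg_bounds(2)[of x] tile_arg_bounds(1)[of y]
    unfolding tile_def arctan_less_iff by linarith
qed

lemma tile_eq_iff [simp]: "tile n x = tile m y \<longleftrightarrow> n = m \<and> x = y"
  using tile_less[of n m x y] tile_less[of m n y x] tile_less_iff[of n x y] tile_less_iff[of n y x]
  by (metis linorder_neqE less_irrefl)

lemma tile_less_pi_half: "tile n x < pi / 2"
  using arctan_ubound unfolding tile_def by blast

lemma tile_neq_pi_half: "tile n x \<noteq> pi / 2"
  using tile_less_pi_half[of n x] by auto

lemma tile_gt: "arctan (real n - 1/2) < tile n x"
  using tile_arg_bounds(1)[of x] unfolding tile_def arctan_less_iff by linarith

text \<open>Combined with \<open>tile_gt\<close>, this is the convergence of the tiles to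
  \<open>pi/2\<close>: all tiles from index \<open>N\<close> on lie above \<open>a\<close>.\<close>

lemma arctan_exceeds:
  assumes "a < pi / 2"
  obtains N :: nat where "\<And>n. n \<ge> N \<Longrightarrow> a < arctan (real n - 1/2)"
proof -
  have "filterlim (\<lambda>n. real n - 1/2) at_top sequentially"
    using filterlim_tendsto_add_at_top[OF tendsto_const[of "- (1/2)"] filterlim_real_sequentially]
    by simp
  then have "((\<lambda>n. arctan (real n - 1/2)) \<longlongrightarrow> pi / 2) sequentially"
    by (rule filterlim_compose[OF tendsto_arctan_at_top])
  then have "eventually (\<lambda>n. a < arctan (real n - 1/2)) sequentially"
    using assms by (rule order_tendstoD)
  then show thesis
    using that unfolding eventually_sequentially by blast
qed

lemma continuous_on_tile: "continuous_on S (tile n)"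
  unfolding tile_def by (intro continuous_intros) auto

text \<open>For compact pieces this is the one-point compactification of their disjoint union, with
  \<open>pi/2\<close> as the point at infinity.\<close>

definition tile_sum :: "(nat \<Rightarrow> real set) \<Rightarrow> real set" where
  "tile_sum W = insert (pi / 2) (\<Union>n. tile n ` W n)"

lemma countable_tile_sum: "(\<And>n. countable (W n)) \<Longrightarrow> countable (tile_sum W)"
  by (auto simp: tile_sum_def)

text \<open>The sum is the intersection of the compact sets obtained by replacing everything from the
  \<open>N\<close>-th piece onwards by a full interval.\<close>
lemma compact_tile_sum:
  assumes "\<And>n. compact (W n)"
  shows "compact (tile_sum W)"
proof -
  define T where "T N = (\<Union>n<N. tile n ` W n) \<union> {arctan (real N - 1/2)..pi/2}" for N
  have "compact (T N)" for N
    unfolding T_def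
    by (intro compact_Un compact_UN compact_continuous_image continuous_on_tile assms) auto
  then have "compact (\<Inter>(range T))"
    by (intro compact_Inter) auto
  moreover have "\<Inter>(range T) = tile_sum W"
  proof
    show "tile_sum W \<subseteq> \<Inter>(range T)"
    proof (clarify)
      fix y N assume y: "y \<in> tile_sum W"
      show "y \<in> T N"
      proof (cases "y = pi/2")
        case True
        then show ?thesis
          using arctan_ubound[of "real N - 1/2"] by (simp add: T_def)
      next
        case False
        then obtain n x where nx: "x \<in> W n" "y = tile n x"
          using y by (auto simp: tile_sum_def)
        show ?thesis
        proof (cases "n < N")
          case True
          then show ?thesis using nx by (auto simp: T_def)
        next
          case False
          then have "arctan (real N - 1/2) \<le> arctan (real n - 1/2)"
            by (simp add: arctan_le_iff)
          then show ?thesis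
            using tile_gt[of n x] tile_less_pi_half[of n x] nx by (auto simp: T_def)
        qed
      qed
    qed
    show "\<Inter>(range T) \<subseteq> tile_sum W"
    proof
      fix y assume y: "y \<in> \<Inter>(range T)"
      show "y \<in> tile_sum W"
      proof (cases "y < pi/2")
        case True
        then obtain N where N: "y < arctan (real N - 1/2)"
          using arctan_exceeds by blast
        have "y \<in> T N"
          using y by blast
        with N show ?thesis
          by (auto simp: T_def tile_sum_def)
      next
        case False
        \<comment> \<open>\<open>T 0\<close> contains no pieces, only an interval ending at
          \<open>pi/2\<close>, which forces \<open>y = pi/2\<close>.\<close>
        have "y \<in> T 0" using y by blast
        with False show ?thesis
          by (auto simp: T_def tile_sum_def)
      qed
    qed
  qed
  ultimately show ?thesis by simp
qed

text \<open>The maps \<open>f n\<close> are glued, with \<open>p\<close> sent to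
  \<open>pi/2\<close>. On each piece continuity is inherited because the piece is open in
  \<open>X\<close>; at \<open>p\<close> it holds because each piece is closed and misses
  \<open>p\<close>, so close to \<open>p\<close> only pieces of large index occur. Compactness of
  \<open>X\<close> turns the continuous bijection into a homeomorphism.\<close>

lemma homeomorphic_tile_sum:
  fixes X :: "real set"
  assumes X: "compact X" "X = insert p (\<Union>n. V n)" and p: "\<And>n. p \<notin> V n"
    and disj: "disjoint_family V"
    and V: "\<And>n. openin (top_of_set X) (V n)" "\<And>n. compact (V n)"
    and f: "\<And>n. continuous_on (V n) (f n)" "\<And>n. inj_on (f n) (V n)"
  shows "X homeomorphic tile_sum (\<lambda>n. f n ` V n)"
proof -
  define ix where "ix x = (THE n. x \<in> V n)" for x
  have ix: "ix x = n" if "x \<in> V n" for x n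
    unfolding ix_def using that disj by (auto simp: disjoint_family_on_def)
  define F where "F x = (if x = p then pi/2 else tile (ix x) (f (ix x) x))" for x
  have Fp: "F p = pi/2"
    by (simp add: F_def)
  have FV: "F x = tile n (f n x)" if "x \<in> V n" for x n
    using that p ix by (auto simp: F_def)
  have "continuous (at x within X) F" if "x \<in> X" for x
  proof (cases "x = p")
    case True
    have "(F \<longlongrightarrow> pi/2) (at p within X)"
    proof (rule order_tendstoI)
      fix a assume "a < pi/2"
      then obtain N where N: "\<And>n. n \<ge> N \<Longrightarrow> a < arctan (real n - 1/2)"
        using arctan_exceeds by blast
      have "eventually (\<lambda>y. y \<notin> V n) (at p within X)" for n
      proof -
        have "open (- V n)" "p \<in> - V n"
          using V(2)[of n] p by (auto simp: compact_imp_closed open_Compl)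
        then show ?thesis
          unfolding eventually_at_topological by (intro exI[of _ "- V n"]) auto
      qed
      \<comment> \<open>Only the finitely many pieces below \<open>N\<close> have to be avoided; all
        later tiles already lie above \<open>a\<close>.\<close>
      then have "eventually (\<lambda>y. \<forall>n\<in>{..<N}. y \<notin> V n) (at p within X)"
        by (intro eventually_ball_finite) auto
      moreover have "eventually (\<lambda>y. y \<in> X) (at p within X)"
        by (simp add: eventually_at_filter)
      ultimately show "eventually (\<lambda>y. a < F y) (at p within X)"
      proof eventually_elim
        case (elim y)
        show ?case
        proof (cases "y = p")
          case True
          then show ?thesis using \<open>a < pi/2\<close> Fp by simp
        next
          case False
          then obtain n where n: "y \<in> V n"
            using elim X(2) by blast
          with elim have "n \<ge> N"
            by (meson lessThan_iff not_le)
          then show ?thesis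
            using FV[OF n] N[of n] tile_gt[of n "f n y"] by linarith
        qed
      qed
    next
      fix a assume "pi/2 < a"
      moreover have "F y \<le> pi/2" for y
        using tile_less_pi_half[of "ix y" "f (ix y) y"] by (simp add: F_def)
      ultimately show "eventually (\<lambda>y. F y < a) (at p within X)"
        by (intro always_eventually) (metis le_less_trans)
    qed
    then show ?thesis
      by (simp add: True continuous_within Fp)
  next
    case False
    then obtain n where n: "x \<in> V n"
      using \<open>x \<in> X\<close> X(2) by blast
    obtain T where T: "open T" "V n = X \<inter> T"
      using V(1)[of n] by (auto simp: openin_open)
    \<comment> \<open>Openness of \<open>V n\<close> in \<open>X\<close> makes continuity at
      \<open>x\<close> a matter of \<open>V n\<close> alone, where \<open>F\<close> is given by a
      single formula.\<close>
    have "at x within X = at x within V n"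
      using T n by (intro at_within_nhd[of x T]) auto
    moreover have "continuous_on (V n) (\<lambda>x. tile n (f n x))"
      by (rule continuous_on_compose2[OF continuous_on_tile[of UNIV] f(1)]) auto
    then have "continuous_on (V n) F"
      by (rule continuous_on_eq) (simp add: FV)
    ultimately show ?thesis
      using n by (simp add: continuous_on_eq_continuous_within)
  qed
  then have "continuous_on X F"
    by (simp add: continuous_on_eq_continuous_within)
  moreover have "F ` X = tile_sum (\<lambda>n. f n ` V n)"
    using Fp FV by (force simp: X(2) tile_sum_def image_iff)
  moreover have "inj_on F X"
  proof (rule inj_onI)
    fix x y assume xy: "x \<in> X" "y \<in> X" "F x = F y"
    show "x = y"
    proof (cases "x = p \<or> y = p")
      case True
      then show ?thesis
        using xy tile_neq_pi_half unfolding F_def by metis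
    next
      case False
      then obtain n m where nm: "x \<in> V n" "y \<in> V m"
        using xy X(2) by blast
      then show ?thesis
        using xy(3) f(2) by (auto simp: FV inj_on_def)
    qed
  qed
  ultimately show ?thesis
    using homeomorphic_compact X(1) by blast
qed

section \<open>Countable compact sets are homeomorphic to well-ordered ones\<close>

text \<open>As the order on the reals is linear, this is well-ordering of \<open>W\<close> by
  \<open>\<le>\<close>.\<close>

definition has_minima :: "real set \<Rightarrow> bool" where
  "has_minima W \<longleftrightarrow> (\<forall>B. B \<subseteq> W \<longrightarrow> B \<noteq> {} \<longrightarrow> (\<exists>m\<in>B. \<forall>b\<in>B. m \<le> b))"

text \<open>The sum is ordered lexicographically: take the least index whose tile meets
  \<open>B\<close>, then the minimum inside that tile. The top point \<open>pi/2\<close> matters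
  only when \<open>B\<close> is that singleton.\<close>

lemma has_minima_tile_sum:
  assumes "\<And>n. has_minima (W n)"
  shows "has_minima (tile_sum W)"
  unfolding has_minima_def
proof (intro allI impI)
  fix B assume B: "B \<subseteq> tile_sum W" "B \<noteq> {}"
  show "\<exists>m\<in>B. \<forall>b\<in>B. m \<le> b"
  proof (cases "B = {pi/2}")
    case False
    define I where "I n \<longleftrightarrow> (\<exists>x\<in>W n. tile n x \<in> B)" for n
    have "\<exists>n. I n"
      using B False unfolding tile_sum_def I_def by blast
    then have least: "I (Least I)" "\<And>n. I n \<Longrightarrow> Least I \<le> n"
      by (metis LeastI, simp add: Least_le)
    define n where "n = Least I"
    obtain m where m: "m \<in> W n" "tile n m \<in> B"
      "\<And>x. x \<in> W n \<Longrightarrow> tile n x \<in> B \<Longrightarrow> m \<le> x"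
    proof -
      have "{x \<in> W n. tile n x \<in> B} \<subseteq> W n" "{x \<in> W n. tile n x \<in> B} \<noteq> {}"
        using least(1) by (auto simp: I_def n_def)
      then obtain m where "m \<in> {x \<in> W n. tile n x \<in> B}" "\<forall>x\<in>{x \<in> W n. tile n x \<in> B}. m \<le> x"
        using assms[of n] unfolding has_minima_def by meson
      then show thesis
        by (intro that[of m]) auto
    qed
    have "tile n m \<le> b" if "b \<in> B" for b
    proof (cases "b = pi/2")
      case True
      then show ?thesis
        using tile_less_pi_half[of n m] by simp
    next
      case False
      then obtain k x where k: "x \<in> W k" "b = tile k x"
        using \<open>b \<in> B\<close> B unfolding tile_sum_def by blast
      then have "n \<le> k"
        using least(2) that unfolding n_def I_def by blast
      then show ?thesis
        using k m(3) that tile_less[of n k m x] by (cases "n = k") auto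
    qed
    with m(2) show ?thesis by blast
  next
    case True
    then show ?thesis
      by (metis order_refl singletonD singletonI)
  qed
qed

definition homeo_well_ordered :: "real set \<Rightarrow> bool" where
  "homeo_well_ordered U \<longleftrightarrow> (\<exists>W. compact W \<and> has_minima W \<and> U homeomorphic W)"

lemma homeo_well_ordered_compact: "homeo_well_ordered U \<Longrightarrow> compact U"
  using homeomorphic_compactness unfolding homeo_well_ordered_def by blast

lemma homeo_well_ordered_subset:
  assumes "homeo_well_ordered U" "compact V" "V \<subseteq> U"
  shows "homeo_well_ordered V"
proof -
  obtain W f g where W: "has_minima W" and fg: "homeomorphism U W f g"
    using assms(1) unfolding homeo_well_ordered_def homeomorphic_def by blast
  have sub: "f ` V \<subseteq> W"
    using fg assms(3) by (auto simp: homeomorphism_def)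
  have "homeomorphism V (f ` V) f g"
    using homeomorphism_of_subsets[OF fg assms(3) sub] by simp
  moreover have "compact (f ` V)"
    using calculation assms(2) homeomorphism_cont1 compact_continuous_image by blast
  moreover have "has_minima (f ` V)"
    using W sub by (auto simp: has_minima_def)
  ultimately show ?thesis
    unfolding homeo_well_ordered_def homeomorphic_def by blast
qed

lemma countable_real_gap:
  fixes a b :: real
  assumes "countable X" "a < b"
  obtains c where "a < c" "c < b" "c \<notin> X"
proof -
  have "\<not> {a<..<b} \<subseteq> X"
    using assms countable_subset uncountable_open_interval by blast
  then show thesis
    using that by (meson greaterThanLessThan_iff subsetI)
qed

text \<open>A countable set misses points of every nondegenerate interval. With \<open>a\<close> and
  \<open>b\<close> chosen outside \<open>X\<close>, the open and the closed interval cut out the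
  same part of \<open>X\<close>, which is thus both open and closed in \<open>X\<close>.\<close>

lemma clopen_nbhd:
  fixes X :: "real set"
  assumes "countable X" "0 < e"
  obtains a b where "x \<in> {a<..<b}" "{a..b} \<subseteq> ball x e" "X \<inter> {a<..<b} = X \<inter> {a..b}"
proof -
  obtain a where a: "x - e < a" "a < x" "a \<notin> X"
    using countable_real_gap[OF assms(1), of "x - e" x] assms(2) by auto
  obtain b where b: "x < b" "b < x + e" "b \<notin> X"
    using countable_real_gap[OF assms(1), of x "x + e"] assms(2) by auto
  show thesis
  proof
    show "X \<inter> {a<..<b} = X \<inter> {a..b}"
      using a b by (auto simp: less_le)
  qed (use a b in \<open>auto simp: dist_real_def\<close>)
qed

text \<open>Shrinking the neighbourhoods away from \<open>p\<close> and enumerating the points of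
  \<open>X - {p}\<close> gives a countable clopen cover of \<open>X - {p}\<close>. Made disjoint,
  its members are the pieces of a \<open>tile_sum\<close> in which \<open>p\<close> becomes the
  limit point \<open>pi/2\<close>.\<close>

lemma homeo_well_ordered_local_away:
  fixes X :: "real set"
  assumes X: "compact X" "countable X" "p \<in> X"
    and loc: "\<And>y. y \<in> X - {p} \<Longrightarrow> \<exists>T. openin (top_of_set X) T \<and> y \<in> T \<and> homeo_well_ordered T"
  shows "homeo_well_ordered X"
proof -
  have "\<exists>T. openin (top_of_set X) T \<and> y \<in> T \<and> homeo_well_ordered T \<and> p \<notin> T" if y: "y \<in> X - {p}" for y
  proof -
    obtain T where T: "openin (top_of_set X) T" "y \<in> T" "homeo_well_ordered T"
      using loc[OF y] by blast
    \<comment> \<open>With the distance to \<open>p\<close> as radius, the ball around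
      \<open>y\<close> excludes \<open>p\<close>.\<close>
    have "0 < dist y p"
      using y by auto
    then obtain a b where ab: "y \<in> {a<..<b}" "{a..b} \<subseteq> ball y (dist y p)"
        "X \<inter> {a<..<b} = X \<inter> {a..b}"
      using clopen_nbhd[OF X(2)] by blast
    have eq: "T \<inter> {a<..<b} = T \<inter> {a..b}"
      using ab(3) openin_imp_subset[OF T(1)] by blast
    have "openin (top_of_set X) (T \<inter> {a<..<b})"
      using T(1) by (intro openin_Int_open) auto
    moreover have "homeo_well_ordered (T \<inter> {a..b})"
      by (rule homeo_well_ordered_subset[OF T(3)])
        (auto intro: compact_Int homeo_well_ordered_compact[OF T(3)])
    moreover have "p \<notin> T \<inter> {a..b}"
      using ab(2) by auto
    ultimately show ?thesis
      using eq ab(1) T(2) by (metis IntI)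
  qed
  then obtain N where N: "\<And>y. y \<in> X - {p} \<Longrightarrow>
      openin (top_of_set X) (N y) \<and> y \<in> N y \<and> homeo_well_ordered (N y) \<and> p \<notin> N y"
    by metis
  \<comment> \<open>The empty set is the default when \<open>X = {p}\<close>, where
    \<open>from_nat_into\<close> has nothing to enumerate.\<close>
  define M where "M n = (if X - {p} = {} then {} else N (from_nat_into (X - {p}) n))" for n
  have empty: "homeo_well_ordered {}"
    unfolding homeo_well_ordered_def by (intro exI[of _ "{}"]) (auto simp: has_minima_def)
  have M: "openin (top_of_set X) (M n)" "homeo_well_ordered (M n)" "p \<notin> M n" for n
    using N[of "from_nat_into (X - {p}) n"] from_nat_into[of "X - {p}" n] empty
    by (auto simp: M_def)
  have MX: "(\<Union>n. M n) = X - {p}"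
  proof
    show "(\<Union>n. M n) \<subseteq> X - {p}"
      using M openin_imp_subset by blast
    show "X - {p} \<subseteq> (\<Union>n. M n)"
    proof
      fix y assume y: "y \<in> X - {p}"
      then obtain n where "from_nat_into (X - {p}) n = y"
        using from_nat_into_surj[of "X - {p}" y] X(2) by auto
      then show "y \<in> (\<Union>n. M n)"
        using N[OF y] y by (auto simp: M_def)
    qed
  qed
  define V where "V = disjointed M"
  \<comment> \<open>Two descriptions of the same pieces: as an intersection of compact sets, for
    compactness, and as an open set minus a relatively closed one, for openness.\<close>
  have V_alt: "V n = M n \<inter> (X - (\<Union>i<n. M i))" for n
    using openin_imp_subset[OF M(1)[of n]] by (auto simp: V_def disjointed_def atLeast0LessThan)
  have V_alt': "V n = M n - (\<Union>i<n. M i)" for n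
    by (auto simp: V_def disjointed_def atLeast0LessThan)
  have closedM: "closedin (top_of_set X) (\<Union>i<n. M i)" for n
    using M(1,2) by (intro closedin_Union)
      (auto intro!: closed_subset compact_imp_closed homeo_well_ordered_compact dest: openin_imp_subset)
  have openV: "openin (top_of_set X) (V n)" for n
    unfolding V_alt' using M(1) closedM by (rule openin_diff)
  have compV: "compact (V n)" for n
  proof -
    have "openin (top_of_set X) (\<Union>i<n. M i)"
      using M(1) by blast
    then have "closedin (top_of_set X) (X - (\<Union>i<n. M i))"
      by (metis closedin_diff closedin_topspace topspace_euclidean_subtopology)
    then have "compact (X - (\<Union>i<n. M i))"
      using X(1) closedin_compact by blast
    then show ?thesis
      unfolding V_alt using M(2) homeo_well_ordered_compact by (blast intro: compact_Int)
  qed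
  have "homeo_well_ordered (V n)" for n
    by (rule homeo_well_ordered_subset[OF M(2)[of n] compV]) (auto simp: V_alt)
  then obtain W f g where W: "\<And>n. compact (W n)" "\<And>n. has_minima (W n)"
      and fg: "\<And>n. homeomorphism (V n) (W n) (f n) (g n)"
    unfolding homeo_well_ordered_def homeomorphic_def by metis
  have im: "f n ` V n = W n" for n
    using fg homeomorphism_image1 by blast
  have "X homeomorphic tile_sum (\<lambda>n. f n ` V n)"
  proof (rule homeomorphic_tile_sum[OF X(1)])
    show "X = insert p (\<Union>n. V n)"
      using MX X(3) UN_disjointed_eq[of M] by (auto simp: V_def)
    show "p \<notin> V n" for n
      using M(3) by (simp add: V_alt)
    show "disjoint_family V"
      using disjoint_family_disjointed[of M] by (simp add: V_def)
    show "continuous_on (V n) (f n)" for n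
      using fg homeomorphism_cont1 by blast
    show "inj_on (f n) (V n)" for n
      using homeomorphism_apply1[OF fg] by (rule inj_on_inverseI)
  qed (use openV compV in auto)
  then show ?thesis
    unfolding im homeo_well_ordered_def
    using W compact_tile_sum has_minima_tile_sum by blast
qed

text \<open>If every point were a limit point, each \<open>S - {x}\<close> would be open and dense
  in \<open>S\<close>; by Baire the countable intersection of these sets would be dense, yet it is
  empty.\<close>

lemma countable_closed_has_isolated_point:
  fixes S :: "real set"
  assumes "closed S" "countable S" "S \<noteq> {}"
  shows "\<exists>x\<in>S. \<not> x islimpt S"
proof (rule ccontr)
  assume "\<not> ?thesis"
  then have lim: "x islimpt S" if "x \<in> S" for x
    using that by blast
  have "S \<subseteq> closure (\<Inter>((\<lambda>x. S - {x}) ` S))"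
  proof (rule Baire[OF assms(1)])
    fix T assume "T \<in> (\<lambda>x. S - {x}) ` S"
    then obtain x where x: "x \<in> S" "T = S - {x}"
      by blast
    have "openin (top_of_set S) T"
      using x by (simp add: openin_delete)
    moreover have "x \<in> closure (S - {x})"
      using lim[OF x(1)] by (simp add: islimpt_in_closure)
    then have "S \<subseteq> closure T"
      using x closure_subset[of "S - {x}"] by blast
    ultimately show "openin (top_of_set S) T \<and> S \<subseteq> closure T"
      by blast
  qed (use assms in auto)
  moreover have "\<Inter>((\<lambda>x. S - {x}) ` S) = {}"
    using assms(3) by blast
  ultimately show False
    using assms(3) by simp
qed

lemma homeo_well_ordered_countable_compact:
  assumes K: "compact K" "countable K"
  shows "homeo_well_ordered K"
proof -
  define good where
    "good y \<longleftrightarrow> (\<exists>T. openin (top_of_set K) T \<and> y \<in> T \<and> homeo_well_ordered T)" for y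
  define B where "B = {y \<in> K. \<not> good y}"
  have "B = {}"
  proof (rule ccontr)
    assume "B \<noteq> {}"
    have "openin (top_of_set K) {y \<in> K. good y}"
    proof (subst openin_subopen, intro ballI)
      fix y assume "y \<in> {y \<in> K. good y}"
      then obtain T where T: "openin (top_of_set K) T" "y \<in> T" "homeo_well_ordered T"
        unfolding good_def by blast
      then have "T \<subseteq> {y \<in> K. good y}"
        using openin_imp_subset unfolding good_def by blast
      with T show "\<exists>T. openin (top_of_set K) T \<and> y \<in> T \<and> T \<subseteq> {y \<in> K. good y}"
        by blast
    qed
    then have "closedin (top_of_set K) (K - {y \<in> K. good y})"
      by (metis closedin_diff closedin_topspace topspace_euclidean_subtopology)
    moreover have "K - {y \<in> K. good y} = B"
      by (auto simp: B_def)
    ultimately have "closed B"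
      using K(1) closedin_compact compact_imp_closed by metis
    moreover have "countable B"
      using K(2) by (auto simp: B_def intro: countable_subset)
    ultimately obtain x where x: "x \<in> B" "\<not> x islimpt B"
      using \<open>B \<noteq> {}\<close> countable_closed_has_isolated_point by blast
    \<comment> \<open>Within distance \<open>e\<close> of \<open>x\<close>, every other point of
      \<open>K\<close> is good, so \<open>x\<close> can serve as the exceptional point of
      \<open>homeo_well_ordered_local_away\<close>.\<close>
    then obtain e where e: "0 < e" "\<And>y. y \<in> B \<Longrightarrow> dist y x < e \<Longrightarrow> y = x"
      unfolding islimpt_approachable by blast
    obtain a b where ab: "x \<in> {a<..<b}" "{a..b} \<subseteq> ball x e" "K \<inter> {a<..<b} = K \<inter> {a..b}"
      using clopen_nbhd[OF K(2) e(1)] by blast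
    define X where "X = K \<inter> {a..b}"
    have xK: "x \<in> K"
      using x(1) by (simp add: B_def)
    have openX: "openin (top_of_set K) X"
      unfolding X_def ab(3)[symmetric] by (simp add: openin_open_Int)
    have "homeo_well_ordered X"
    proof (rule homeo_well_ordered_local_away)
      show "compact X" "countable X" "x \<in> X"
        using K xK ab(1) by (auto simp: X_def compact_Int intro: countable_subset)
      fix y assume y: "y \<in> X - {x}"
      then have "y \<notin> B"
        using e(2)[of y] ab(2) by (force simp: X_def dist_commute)
      then obtain T where T: "openin (top_of_set K) T" "y \<in> T" "homeo_well_ordered T"
        using y by (auto simp: B_def good_def X_def)
      have "openin (top_of_set X) (X \<inter> T)"
        using T(1) by (auto simp: openin_open X_def)
      moreover have "homeo_well_ordered (X \<inter> T)"
        by (rule homeo_well_ordered_subset[OF T(3)])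
          (use \<open>compact X\<close> homeo_well_ordered_compact[OF T(3)] in \<open>auto simp: compact_Int\<close>)
      ultimately show "\<exists>T. openin (top_of_set X) T \<and> y \<in> T \<and> homeo_well_ordered T"
        using y T(2) by blast
    qed
    then have "good x"
      unfolding good_def using openX xK ab(1) by (auto simp: X_def)
    then show False
      using x(1) by (simp add: B_def)
  qed
  \<comment> \<open>Now every point of \<open>K\<close> is good, but the local lemma asks for an
    exceptional point. A point outside \<open>K\<close> is adjoined for this purpose;
    \<open>K\<close> is open in \<open>insert p K\<close>, so good neighbourhoods stay open.\<close>
  obtain p where p: "p \<notin> K"
    using K(2) uncountable_UNIV_real by (metis UNIV_eq_I)
  have "homeo_well_ordered (insert p K)"
  proof (rule homeo_well_ordered_local_away)
    fix y assume "y \<in> insert p K - {p}"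
    then have "good y"
      using \<open>B = {}\<close> by (auto simp: B_def)
    then obtain T where T: "openin (top_of_set K) T" "y \<in> T" "homeo_well_ordered T"
      unfolding good_def by blast
    have "openin (top_of_set (insert p K)) (insert p K - {p})"
      by (intro openin_delete) simp
    then have "openin (top_of_set (insert p K)) K"
      using p by simp
    then have "openin (top_of_set (insert p K)) T"
      using T(1) openin_trans by blast
    with T show "\<exists>T. openin (top_of_set (insert p K)) T \<and> y \<in> T \<and> homeo_well_ordered T"
      by blast
  qed (use K in auto)
  then show ?thesis
    by (rule homeo_well_ordered_subset) (use K in auto)
qed

section \<open>At most \<open>\<aleph>\<^sub>1\<close> classes\<close>

text \<open>If \<open>a < f x\<close> and some values are at most \<open>a\<close>, closedness of
  the image yields a largest such value \<open>f z\<close>. Then \<open>z < x\<close>, and every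
  point of \<open>A\<close> beyond \<open>z\<close> has value above \<open>a\<close>. The upper
  bound is symmetric, with a smallest value.\<close>

lemma strict_mono_on_closed_image_continuous:
  fixes f :: "real \<Rightarrow> real"
  assumes f: "strict_mono_on A f" and closed: "closed (f ` A)"
  shows "continuous_on A f"
  unfolding continuous_on_def
proof (intro ballI order_tendstoI)
  fix x a assume x: "x \<in> A"
  have inA: "eventually (\<lambda>y. y \<in> A) (at x within A)"
    by (simp add: eventually_at_filter)
  have less: "f y < f z \<longleftrightarrow> y < z" if "y \<in> A" "z \<in> A" for y z
    using f that by (metis strict_mono_on_less)
  show "eventually (\<lambda>y. a < f y) (at x within A)" if a: "a < f x"
  proof (cases "f ` A \<inter> {..a} = {}")
    case True
    then have "\<forall>y\<in>A. a < f y"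
      by (auto simp: not_le[symmetric])
    then show ?thesis
      using inA by (auto elim: eventually_mono)
  next
    case False
    have "closed (f ` A \<inter> {..a})" "bdd_above (f ` A \<inter> {..a})"
      using closed by (simp_all add: closed_Int)
    then have "Sup (f ` A \<inter> {..a}) \<in> f ` A \<inter> {..a}"
      using False by (intro closed_contains_Sup)
    then obtain z where z: "z \<in> A" "f z = Sup (f ` A \<inter> {..a})" "f z \<le> a"
      by auto
    have max: "f y \<le> f z" if "y \<in> A" "f y \<le> a" for y
      using that z(2) \<open>bdd_above _\<close> by (auto intro: cSup_upper)
    have "z < x"
      using less[OF z(1) x] z(3) a by linarith
    then have "eventually (\<lambda>y. z < y) (at x within A)"
      using order_tendstoD(1)[OF tendsto_ident_at] by blast
    with inA show ?thesis
    proof eventually_elim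
      case (elim y)
      then show ?case
        using less[OF z(1), of y] max[of y] by force
    qed
  qed
  show "eventually (\<lambda>y. f y < a) (at x within A)" if a: "f x < a"
  proof (cases "f ` A \<inter> {a..} = {}")
    case True
    then have "\<forall>y\<in>A. f y < a"
      by (auto simp: not_le[symmetric])
    then show ?thesis
      using inA by (auto elim: eventually_mono)
  next
    case False
    have "closed (f ` A \<inter> {a..})" "bdd_below (f ` A \<inter> {a..})"
      using closed by (simp_all add: closed_Int)
    then have "Inf (f ` A \<inter> {a..}) \<in> f ` A \<inter> {a..}"
      using False by (intro closed_contains_Inf)
    then obtain z where z: "z \<in> A" "f z = Inf (f ` A \<inter> {a..})" "a \<le> f z"
      by auto
    have min: "f z \<le> f y" if "y \<in> A" "a \<le> f y" for y
      using that z(2) \<open>bdd_below _\<close> by (auto intro: cInf_lower)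
    have "x < z"
      using less[OF x z(1)] z(3) a by linarith
    then have "eventually (\<lambda>y. y < z) (at x within A)"
      using order_tendstoD(2)[OF tendsto_ident_at] by blast
    with inA show ?thesis
    proof eventually_elim
      case (elim y)
      then show ?case
        using less[OF _ z(1), of y] min[of y] by force
    qed
  qed
qed

text \<open>The order is restricted to a relation with field \<open>W\<close>, so that the theory of
  well-orders and \<open>=o\<close> applies to \<open>W\<close>.\<close>

definition le_on :: "real set \<Rightarrow> real rel" where
  "le_on W = {(x, y). x \<in> W \<and> y \<in> W \<and> x \<le> y}"

lemma Field_le_on: "Field (le_on W) = W"
  by (auto simp: le_on_def Field_def)

lemma Well_order_le_on:
  assumes "has_minima W"
  shows "Well_order (le_on W)"
proof -
  have lin: "Linear_order (le_on W)"
    unfolding order_on_defs Field_le_on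
    by (auto simp: le_on_def refl_on_def trans_def antisym_def total_on_def)
  have "wf (le_on W - Id)"
  proof (rule wfI_min)
    fix x Q assume x: "x \<in> (Q :: real set)"
    show "\<exists>z\<in>Q. \<forall>y. (y, z) \<in> le_on W - Id \<longrightarrow> y \<notin> Q"
    proof (cases "Q \<inter> W = {}")
      case True
      then show ?thesis
        using x by (auto simp: le_on_def)
    next
      case False
      then obtain m where "m \<in> Q \<inter> W" "\<forall>b\<in>Q \<inter> W. m \<le> b"
        using assms unfolding has_minima_def by (meson inf_le2)
      then show ?thesis
        by (intro bexI[of _ m]) (force simp: le_on_def)+
    qed
  qed
  with lin show ?thesis
    unfolding well_order_on_def by blast
qed

text \<open>An order isomorphism is a strictly increasing map onto the closed set \<open>W'\<close>,
  hence continuous; compactness of \<open>W\<close> does the rest.\<close>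

lemma ordIso_le_on_homeomorphic:
  assumes "compact W" "compact W'" "le_on W =o le_on W'"
  shows "W homeomorphic W'"
proof -
  obtain f where f: "iso (le_on W) (le_on W') f"
    using assms(3) unfolding ordIso_def by blast
  then have bij: "bij_betw f W W'"
    and mono: "\<And>a b. a \<in> W \<Longrightarrow> b \<in> W \<Longrightarrow> (a, b) \<in> le_on W \<longleftrightarrow> (f a, f b) \<in> le_on W'"
    unfolding iso_iff2 Field_le_on by auto
  have le: "a \<le> b \<longleftrightarrow> f a \<le> f b" if "a \<in> W" "b \<in> W" for a b
    using mono[OF that] that bij by (auto simp: le_on_def bij_betw_def)
  have "strict_mono_on W f"
    by (rule strict_mono_onI) (metis le not_le)
  moreover have "f ` W = W'"
    using bij by (simp add: bij_betw_def)
  ultimately have "continuous_on W f"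
    using assms(2) by (intro strict_mono_on_closed_image_continuous) (auto intro: compact_imp_closed)
  then show ?thesis
    using homeomorphic_compact[OF assms(1)] bij unfolding bij_betw_def by blast
qed

text \<open>Well-orders are comparable, and \<open>aleph1 \<le>o le_on W\<close> would make the
  field of \<open>aleph1\<close> countable.\<close>

lemma le_on_ordLess_aleph1:
  assumes "countable W" "has_minima W"
  shows "le_on W <o aleph1"
proof -
  have wo: "Well_order (le_on W)" "Well_order aleph1"
    using assms(2) Well_order_le_on natLeq_Card_order cardSuc_Well_order
    by (auto simp: aleph1_def)
  have "\<not> aleph1 \<le>o le_on W"
  proof
    assume "aleph1 \<le>o le_on W"
    then have "|Field aleph1| \<le>o |W|"
      using card_of_mono2 Field_le_on by metis
    also have "|W| \<le>o natLeq"
      using assms(1) countable_card_le_natLeq by blast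
    finally have "|Field aleph1| \<le>o natLeq" .
    moreover have "|Field aleph1| =o aleph1"
      unfolding aleph1_def
      using card_of_Field_ordIso cardSuc_Card_order natLeq_Card_order by blast
    ultimately have "aleph1 \<le>o natLeq"
      using ordIso_ordLeq_trans ordIso_symmetric by blast
    then show False
      using cardSuc_greater[OF natLeq_Card_order] not_ordLess_ordLeq unfolding aleph1_def by blast
  qed
  then show ?thesis
    using wo by (simp add: not_ordLeq_iff_ordLess)
qed

text \<open>Each class contains a compact well-ordered \<open>W\<close> isomorphic to a proper
  initial segment of \<open>aleph1\<close>. The element cutting off that segment determines the
  order type, hence the homeomorphism type, so classes inject into the field of
  \<open>aleph1\<close>.\<close>

lemma card_of_classes_ordLeq_aleph1: "|countable_compacts // cont_bij_rel| \<le>o aleph1"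
proof -
  have wo: "Well_order aleph1"
    using natLeq_Card_order cardSuc_Well_order by (auto simp: aleph1_def)
  have "\<exists>a W. a \<in> Field aleph1 \<and> W \<in> c \<and> compact W \<and> le_on W =o Restr aleph1 (underS aleph1 a)"
    if "c \<in> countable_compacts // cont_bij_rel" for c
  proof -
    obtain K where K: "K \<in> countable_compacts" "c = cont_bij_rel `` {K}"
      using \<open>c \<in> _\<close> by (auto elim: quotientE)
    obtain W where W: "compact W" "has_minima W" "K homeomorphic W"
      using homeo_well_ordered_countable_compact K(1)
      unfolding countable_compacts_def homeo_well_ordered_def by blast
    have "countable W"
      using W(3) K(1) unfolding countable_compacts_def homeomorphic_def homeomorphism_def
      by (metis (mono_tags, lifting) countable_image mem_Collect_eq)
    with W K have "W \<in> c"
      by (auto simp: cont_bij_rel_iff_homeomorphic countable_compacts_def)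
    moreover obtain a where "a \<in> Field aleph1" "le_on W =o Restr aleph1 (underS aleph1 a)"
      using le_on_ordLess_aleph1[OF \<open>countable W\<close> W(2)]
        ordLess_iff_ordIso_Restr[OF wo Well_order_le_on[OF W(2)]] by blast
    ultimately show ?thesis
      using W(1) by blast
  qed
  then obtain A W where AW: "\<And>c. c \<in> countable_compacts // cont_bij_rel \<Longrightarrow>
      A c \<in> Field aleph1 \<and> W c \<in> c \<and> compact (W c) \<and>
      le_on (W c) =o Restr aleph1 (underS aleph1 (A c))"
    by metis
  have "inj_on A (countable_compacts // cont_bij_rel)"
  proof (rule inj_onI)
    fix c d assume c: "c \<in> countable_compacts // cont_bij_rel"
      and d: "d \<in> countable_compacts // cont_bij_rel" and eq: "A c = A d"
    have "le_on (W c) =o le_on (W d)"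
      using AW[OF c] AW[OF d] eq ordIso_transitive ordIso_symmetric by metis
    then have "W c homeomorphic W d"
      using AW[OF c] AW[OF d] ordIso_le_on_homeomorphic by blast
    moreover have "W c \<in> countable_compacts" "W d \<in> countable_compacts"
      using AW[OF c] AW[OF d] c d in_quotient_imp_subset[OF equiv_cont_bij_rel] by blast+
    ultimately have "(W c, W d) \<in> cont_bij_rel"
      by (simp add: cont_bij_rel_iff_homeomorphic)
    then show "c = d"
      using quotient_eqI[OF equiv_cont_bij_rel c d] AW[OF c] AW[OF d] by blast
  qed
  then have "|countable_compacts // cont_bij_rel| \<le>o |Field aleph1|"
    using AW by (intro card_of_ordLeq[THEN iffD1]) blast
  also have "|Field aleph1| =o aleph1"
    unfolding aleph1_def
    using card_of_Field_ordIso cardSuc_Card_order natLeq_Card_order by blast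
  finally show ?thesis .
qed

section \<open>Uncountably many classes\<close>

text \<open>Diagonal argument along one branch of a Cantor scheme: inside the current copy of
  \<open>X\<close> sit two disjoint smaller copies, and one that avoids the \<open>n\<close>-th
  point of the enumeration is chosen. The nested compact copies share a point, which the enumeration
  misses.\<close>

lemma two_disjoint_copies_uncountable:
  fixes X :: "'a::{heine_borel} set"
  assumes X: "compact X" "X \<noteq> {}"
    and e: "continuous_on X e0" "inj_on e0 X" "e0 ` X \<subseteq> X"
      "continuous_on X e1" "inj_on e1 X" "e1 ` X \<subseteq> X"
    and disj: "e0 ` X \<inter> e1 ` X = {}"
  shows "uncountable X"
proof
  assume "countable X"
  then obtain s :: "nat \<Rightarrow> 'a" where s: "range s = X"
    using X(2) uncountable_def by blast
  \<comment> \<open>\<open>\<phi> n\<close> is a composite of \<open>n\<close> maps from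
    \<open>e0\<close>, \<open>e1\<close>. Each new map is applied innermost, so that the images of
    \<open>X\<close> decrease.\<close>
  define \<phi> where "\<phi> = rec_nat (\<lambda>x. x)
    (\<lambda>n g. if s n \<in> (\<lambda>x. g (e0 x)) ` X then (\<lambda>x. g (e1 x)) else (\<lambda>x. g (e0 x)))"
  have \<phi>0: "\<phi> 0 = (\<lambda>x. x)"
    and \<phi>S: "\<phi> (Suc n) = (if s n \<in> (\<lambda>x. \<phi> n (e0 x)) ` X then (\<lambda>x. \<phi> n (e1 x)) else (\<lambda>x. \<phi> n (e0 x)))" for n
    by (simp_all add: \<phi>_def)
  have \<phi>: "continuous_on X (\<phi> n) \<and> inj_on (\<phi> n) X" for n
  proof (induction n)
    case (Suc n)
    then have "continuous_on X (\<lambda>x. \<phi> n (e0 x))" "continuous_on X (\<lambda>x. \<phi> n (e1 x))"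
      using e by (auto intro: continuous_on_compose2)
    moreover have "inj_on (\<lambda>x. \<phi> n (e0 x)) X" "inj_on (\<lambda>x. \<phi> n (e1 x)) X"
      using comp_inj_on[OF e(2), of "\<phi> n"] comp_inj_on[OF e(5), of "\<phi> n"]
        inj_on_subset[of "\<phi> n" X] Suc e(3,6) by (simp_all add: comp_def)
    ultimately show ?case
      by (simp add: \<phi>S)
  qed (simp add: \<phi>0)
  define F where "F n = \<phi> n ` X" for n
  have FS: "F (Suc n) \<subseteq> F n" for n
    using e by (auto simp: F_def \<phi>S)
  have "\<Inter>(range F) \<noteq> {}"
  proof (rule compact_nest)
    show "compact (F n)" "F n \<noteq> {}" for n
      using \<phi> X by (auto simp: F_def intro: compact_continuous_image)
    show "F n \<subseteq> F m" if "m \<le> n" for m n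
      using lift_Suc_antimono_le[of F, OF FS that] .
  qed
  then obtain y where y: "\<And>n. y \<in> F n"
    by blast
  then have "y \<in> X"
    using y[of 0] by (simp add: F_def \<phi>0)
  then obtain n where n: "s n = y"
    using s by blast
  have "s n \<notin> F (Suc n)"
  \<comment> \<open>If \<open>s n\<close> lies in the \<open>e0\<close> copy, the \<open>e1\<close>
    copy was chosen, and injectivity of \<open>\<phi> n\<close> keeps the two disjoint; otherwise
    the \<open>e0\<close> copy avoids \<open>s n\<close> outright.\<close>
  proof (cases "s n \<in> (\<lambda>x. \<phi> n (e0 x)) ` X")
    case True
    then obtain u where u: "u \<in> X" "s n = \<phi> n (e0 u)"
      by blast
    have "s n \<noteq> \<phi> n (e1 v)" if "v \<in> X" for v
    proof
      assume "s n = \<phi> n (e1 v)"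
      then have "e0 u = e1 v"
        using u that e \<phi>[of n] by (metis image_subset_iff inj_onD)
      then show False
        using disj u(1) that by blast
    qed
    with True show ?thesis
      by (auto simp: F_def \<phi>S)
  next
    case False
    then show ?thesis
      by (auto simp: F_def \<phi>S)
  qed
  then show False
    using y n by metis
qed

lemma uncountable_classes: "uncountable (countable_compacts // cont_bij_rel)"
proof
  assume count: "countable (countable_compacts // cont_bij_rel)"
  define Q where "Q = countable_compacts // cont_bij_rel"
  \<comment> \<open>The class of the empty set shows \<open>Q\<close> nonempty, so that every value
    of \<open>from_nat_into Q\<close> is a class, even if \<open>Q\<close> is finite.\<close>
  have "{} \<in> countable_compacts"
    by (simp add: countable_compacts_def)
  then have Qne: "Q \<noteq> {}"
    unfolding Q_def by (auto simp: quotient_def)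
  define L where "L n = (SOME K. K \<in> from_nat_into Q n)" for n
  have Lin: "L n \<in> from_nat_into Q n" for n
  proof -
    have "from_nat_into Q n \<noteq> {}"
      using from_nat_into[OF Qne] in_quotient_imp_non_empty[OF equiv_cont_bij_rel]
      unfolding Q_def by blast
    then show ?thesis
      unfolding L_def by (simp add: some_in_eq)
  qed
  have Lcc: "L n \<in> countable_compacts" for n
    using Lin from_nat_into[OF Qne] in_quotient_imp_subset[OF equiv_cont_bij_rel]
    unfolding Q_def by blast
  \<comment> \<open>Every representative is placed twice, so the sum contains two disjoint copies of each.\<close>
  define X where "X = tile_sum (\<lambda>n. L (n div 2))"
  have X: "compact X" "countable X" "X \<noteq> {}"
    using Lcc unfolding X_def
    by (auto intro!: compact_tile_sum countable_tile_sum simp: countable_compacts_def)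
      (simp add: tile_sum_def)
  then have Xcc: "X \<in> countable_compacts"
    by (simp add: countable_compacts_def)
  then have "cont_bij_rel `` {X} \<in> Q"
    unfolding Q_def by (rule quotientI)
  then obtain n where "from_nat_into Q n = cont_bij_rel `` {X}"
    using from_nat_into_surj count unfolding Q_def by metis
  then have "(X, L n) \<in> cont_bij_rel"
    using Lin[of n] by auto
  then obtain f where f: "continuous_on X f" "bij_betw f X (L n)"
    unfolding cont_bij_rel_def by blast
  \<comment> \<open>\<open>X\<close> is homeomorphic to its own representative \<open>L n\<close>,
    which sits in \<open>X\<close> at the indices \<open>2 * n\<close> and \<open>2 * n + 1\<close>;
    following \<open>f\<close> by either tile embeds \<open>X\<close> into itself.\<close>
  have copy: "continuous_on X (\<lambda>x. tile k (f x))" "inj_on (\<lambda>x. tile k (f x)) X"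
      "(\<lambda>x. tile k (f x)) ` X \<subseteq> X" if "k div 2 = n" for k
  proof -
    show "continuous_on X (\<lambda>x. tile k (f x))"
      by (rule continuous_on_compose2[OF continuous_on_tile[of UNIV] f(1)]) auto
    show "inj_on (\<lambda>x. tile k (f x)) X"
      using f(2) by (auto simp: bij_betw_def inj_on_def)
    show "(\<lambda>x. tile k (f x)) ` X \<subseteq> X"
    proof (rule image_subsetI)
      fix x assume "x \<in> X"
      then have "f x \<in> L (k div 2)"
        using f(2) that by (auto simp: bij_betw_def)
      then show "tile k (f x) \<in> X"
        unfolding X_def tile_sum_def by blast
    qed
  qed
  have "(\<lambda>x. tile (2 * n) (f x)) ` X \<inter> (\<lambda>x. tile (2 * n + 1) (f x)) ` X = {}"
    by auto
  then have "uncountable X"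
    using two_disjoint_copies_uncountable[OF X(1,3) copy[of "2 * n"] copy[of "2 * n + 1"]] by simp
  with X(2) show False
    by blast
qed

theorem theorem3p4:
  shows "|countable_compacts // cont_bij_rel| =o aleph1"
proof -
  have "\<not> |countable_compacts // cont_bij_rel| \<le>o natLeq"
    using uncountable_classes countable_card_le_natLeq by blast
  then have "natLeq <o |countable_compacts // cont_bij_rel|"
    using not_ordLeq_iff_ordLess natLeq_Well_order card_of_Well_order by blast
  \<comment> \<open>A cardinal successor is least among the cardinals strictly above, so
    uncountability alone gives the lower bound.\<close>
  then have "aleph1 \<le>o |countable_compacts // cont_bij_rel|"
    unfolding aleph1_def using natLeq_Card_order card_of_Card_order by (blast intro: cardSuc_least)
  then show ?thesis
    using card_of_classes_ordLeq_aleph1 ordIso_iff_ordLeq by blast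
qed

end
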